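(* There is a constant $C$ with $1<C<1.3$ such that the following holds. Let $K\ge 4$ be an integer, $\epsilon\in(0,1)$, $N=100K^2\lceil\log(1/\epsilon)\rceil$, $M\ge K$, let $\mathbf{F}$ be the $N\times M$ optimal probabilistic fingerprint (OPF, Tardos) matrix with parameters $(K,\epsilon)$, and suppose a coalition of size $K$ performs the collusion attack. Let $\mathcal{I}\subseteq\{1,\dots,N\}$ be the set of rows in which the colluders determine their fingerprints. Then the number $N-|\mathcal{I}|$ of rows that they fail to estimate satisfies $$N-|\mathcal{I}|\ \le\ \frac{2CN}{\sqrt K}$$ with probability at least $$1-\frac{\sqrt K-C}{NC}.$$
   Context: Notation: $\log$ is the natural logarithm. OPF (Tardos) matrix with parameters $(K,\epsilon)$. Let $0<t<\pi/4$ be defined by $\sin^2 t=\frac{1}{300K}$. Let $r_1,\dots,r_N$ be i.i.d. uniform on $[t,\frac{\pi}{2}-t]$ and $\varrho_i=\sin^2(r_i)$. Conditionally on $(\varrho_i)_i$, the entries $f_{i,j}\in\{0,1\}$ of $\mathbf{F}$ ($1\le i\le N$, $1\le j\le M$) are independent with $P(f_{i,j}=1)=\varrho_i$. Attack. User $m$ receives $\mathbf{q}_m=\mathbf{s}+\mathbf{f}_m$, with $\mathbf{s}\in\mathbb{R}^N$ an unknown host signal and $\mathbf{f}_m$ the $m$th column of $\mathbf{F}$. The coalition is, without loss of generality, $\{1,\dots,K\}$. The colluders form the $N\times K$ matrix $\mathbf{A}$ with entries $a_{i,j}=f_{i,1}-f_{i,j}$ (the $i$th coordinate of $\mathbf{q}_1-\mathbf{q}_j$).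 If row $i$ of $\mathbf{A}$ has a nonzero entry (which is then $\pm1$), all of $f_{i,1},\dots,f_{i,K}$ are uniquely determined by it; $\mathcal{I}$ is the set of such rows $i$. Thus $N-|\mathcal{I}|$ is the number of rows $i$ in which $f_{i,1}=\dots=f_{i,K}$. *)

theory Defs
  imports "HOL-Probability.Probability"
begin

section \<open>The random fingerprint matrix\<close>

definition opf_cutoff :: "nat \<Rightarrow> real" where
  "opf_cutoff K = (THE t. 0 < t \<and> t < pi / 4 \<and> (sin t)\<^sup>2 = 1 / (300 * real K))"

definition opf_rows :: "nat \<Rightarrow> real \<Rightarrow> nat" where
  "opf_rows K \<epsilon> = 100 * K\<^sup>2 * nat \<lceil>ln (1 / \<epsilon>)\<rceil>"

definition opf_angles :: "nat \<Rightarrow> nat \<Rightarrow> (nat \<Rightarrow> real) measure" where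
  "opf_angles K N =
     (\<Pi>\<^sub>M i\<in>{1..N}. uniform_measure lborel {opf_cutoff K .. pi / 2 - opf_cutoff K})"

text \<open>The law of the matrix given the biases \<open>\<rho> i\<close>. Entry \<open>(i, j)\<close> of a matrix \<open>F\<close> is
  \<open>F (i, j)\<close>; entries outside \<open>{1..N} \<times> {1..M}\<close> are \<open>0\<close> by convention.\<close>

definition opf_given_bias :: "nat \<Rightarrow> nat \<Rightarrow> (nat \<Rightarrow> real) \<Rightarrow> (nat \<times> nat \<Rightarrow> real) pmf" where
  "opf_given_bias N M \<rho> =
     Pi_pmf ({1..N} \<times> {1..M}) 0 (\<lambda>(i, j). map_pmf of_bool (bernoulli_pmf (\<rho> i)))"

definition opf_matrix :: "nat \<Rightarrow> real \<Rightarrow> nat \<Rightarrow> (nat \<times> nat \<Rightarrow> real) measure" where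
  "opf_matrix K \<epsilon> M =
     opf_angles K (opf_rows K \<epsilon>) \<bind>
       (\<lambda>r. measure_pmf (opf_given_bias (opf_rows K \<epsilon>) M (\<lambda>i. (sin (r i))\<^sup>2)))"

section \<open>The collusion attack\<close>

definition received :: "(nat \<Rightarrow> real) \<Rightarrow> (nat \<times> nat \<Rightarrow> real) \<Rightarrow> nat \<Rightarrow> nat \<Rightarrow> real" where
  "received s F m i = s i + F (i, m)"

definition collusion_matrix :: "(nat \<Rightarrow> real) \<Rightarrow> (nat \<times> nat \<Rightarrow> real) \<Rightarrow> nat \<Rightarrow> nat \<Rightarrow> real" where
  "collusion_matrix s F i j = received s F 1 i - received s F j i"

definition determined_rows ::
    "nat \<Rightarrow> nat \<Rightarrow> (nat \<Rightarrow> real) \<Rightarrow> (nat \<times> nat \<Rightarrow> real) \<Rightarrow> nat set" where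
  "determined_rows N K s F = {i\<in>{1..N}. \<exists>j\<in>{1..K}. collusion_matrix s F i j \<noteq> 0}"

section \<open>The definitions are meaningful\<close>

lemma opf_cutoff_unique:
  assumes "K \<ge> 1"
  shows "\<exists>!t. 0 < t \<and> t < pi / 4 \<and> (sin t)\<^sup>2 = 1 / (300 * real K)"
proof -
  define u where "u = 1 / sqrt (300 * real K)"
  have u2: "u\<^sup>2 = 1 / (300 * real K)"
    by (simp add: u_def power_divide)
  have u0: "0 < u"
    using assms by (simp add: u_def)
  have "u\<^sup>2 < (sqrt 2 / 2)\<^sup>2"
    using assms by (simp add: u2 power_divide divide_simps)
  hence u1: "u < sqrt 2 / 2"
    by (rule power_less_imp_less_base) simp
  have "sqrt 2 / 2 \<le> (1::real)"
    using real_le_rsqrt[of 1 2] sqrt2_less_2 by simp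
  hence ule: "u < 1" using u1 by linarith
  have "arcsin u < arcsin (sin (pi / 4))"
    using u0 u1 \<open>sqrt 2 / 2 \<le> 1\<close> by (intro arcsin_less_arcsin) (simp_all add: sin_45)
  hence lt: "arcsin u < pi / 4"
    by (simp add: arcsin_sin)
  have gt: "0 < arcsin u"
    using u0 ule arcsin_less_arcsin[of 0 u] by simp
  show ?thesis
  proof (rule ex1I[of _ "arcsin u"])
    show "0 < arcsin u \<and> arcsin u < pi / 4 \<and> (sin (arcsin u))\<^sup>2 = 1 / (300 * real K)"
      using lt gt u0 ule u2 by simp
  next
    fix t :: real
    assume t: "0 < t \<and> t < pi / 4 \<and> (sin t)\<^sup>2 = 1 / (300 * real K)"
    hence "sin t > 0" by (intro sin_gt_zero) auto
    hence "sin t = u" using t u2 u0 power2_eq_imp_eq[of "sin t" u] by simp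
    moreover have "arcsin (sin t) = t" using t by (intro arcsin_sin) auto
    ultimately show "t = arcsin u" by simp
  qed
qed

lemma opf_cutoff:
  assumes "K \<ge> 1"
  shows "0 < opf_cutoff K" "opf_cutoff K < pi / 4" "(sin (opf_cutoff K))\<^sup>2 = 1 / (300 * real K)"
  using theI'[OF opf_cutoff_unique[OF assms]] unfolding opf_cutoff_def by auto

lemma prob_space_opf_angle:
  assumes "K \<ge> 1"
  shows "prob_space (uniform_measure lborel {opf_cutoff K .. pi / 2 - opf_cutoff K})"
  using opf_cutoff(2)[OF assms] by (intro prob_space_uniform_measure) auto

lemma prob_space_opf_angles:
  assumes "K \<ge> 1"
  shows "prob_space (opf_angles K N)"
  unfolding opf_angles_def by (intro prob_space_PiM prob_space_opf_angle assms)

lemma opf_kernel_measurable: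
  "(\<lambda>r. measure_pmf (opf_given_bias N M (\<lambda>i. (sin (r i))\<^sup>2)))
     \<in> measurable (opf_angles K N) (subprob_algebra (count_space UNIV))"
proof (rule measurable_subprob_algebra)
  fix A :: "(nat \<times> nat \<Rightarrow> real) set"
  let ?I = "{1..N} \<times> {1..M}"
  let ?P = "\<lambda>r. opf_given_bias N M (\<lambda>i. (sin (r i))\<^sup>2)"
  define S :: "(nat \<times> nat \<Rightarrow> real) set" where "S = PiE_dflt ?I 0 (\<lambda>_. {0, 1})"
  have fin: "finite S"
    unfolding S_def by (intro finite_PiE_dflt) auto
  have sub: "set_pmf (?P r) \<subseteq> S" for r
    by (auto simp: opf_given_bias_def S_def set_Pi_pmf PiE_dflt_def of_bool_def
             split: if_splits)
  have ent: "(\<lambda>r. pmf (map_pmf of_bool (bernoulli_pmf ((sin (r i))\<^sup>2))) x)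
      \<in> borel_measurable (opf_angles K N)" if "i \<in> {1..N}" for i and x :: real
  proof -
    have [measurable]: "(\<lambda>r. r i) \<in> borel_measurable (opf_angles K N)"
      unfolding opf_angles_def
      using measurable_component_singleton[OF that,
          of "\<lambda>_. uniform_measure lborel {opf_cutoff K .. pi / 2 - opf_cutoff K}"]
      by (simp cong: measurable_cong_sets)
    have *: "(sin y)\<^sup>2 \<le> 1" for y :: real
      by (simp add: abs_square_le_1)
    have "pmf (map_pmf of_bool (bernoulli_pmf ((sin y)\<^sup>2))) x =
        (if x = 1 then (sin y)\<^sup>2 else if x = 0 then 1 - (sin y)\<^sup>2 else 0)" for y
    proof -
      have "pmf (map_pmf of_bool (bernoulli_pmf ((sin y)\<^sup>2))) x =
          (\<integral>b. indicator (of_bool -` {x}) b \<partial>measure_pmf (bernoulli_pmf ((sin y)\<^sup>2)))"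
        by (simp add: pmf_map)
      also have "\<dots> = (if x = 1 then (sin y)\<^sup>2 else if x = 0 then 1 - (sin y)\<^sup>2 else 0)"
        using *[of y] by (subst integral_bernoulli_pmf) (auto simp: indicator_def)
      finally show ?thesis .
    qed
    thus ?thesis by simp
  qed
  have "measure (?P r) A = (\<Sum>F\<in>A \<inter> S. \<Prod>(i, j)\<in>?I.
      pmf (map_pmf of_bool (bernoulli_pmf ((sin (r i))\<^sup>2))) (F (i, j)))" for r
  proof -
    have "measure (?P r) A = measure (?P r) (A \<inter> S)"
      using sub[of r] by (intro measure_prob_cong_0) (auto simp: set_pmf_eq)
    also have "\<dots> = (\<Sum>F\<in>A \<inter> S. pmf (?P r) F)"
      using fin by (intro measure_measure_pmf_finite) auto
    also have "\<dots> = (\<Sum>F\<in>A \<inter> S. \<Prod>(i, j)\<in>?I.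
        pmf (map_pmf of_bool (bernoulli_pmf ((sin (r i))\<^sup>2))) (F (i, j)))"
    proof (rule sum.cong[OF refl])
      fix F assume "F \<in> A \<inter> S"
      hence "F x = 0" if "x \<notin> ?I" for x
        using that unfolding S_def PiE_dflt_def by blast
      thus "pmf (?P r) F = (\<Prod>(i, j)\<in>?I.
          pmf (map_pmf of_bool (bernoulli_pmf ((sin (r i))\<^sup>2))) (F (i, j)))"
        unfolding opf_given_bias_def by (subst pmf_Pi') (simp_all add: case_prod_unfold)
    qed
    finally show ?thesis .
  qed
  moreover have "(\<lambda>r. \<Sum>F\<in>A \<inter> S. \<Prod>(i, j)\<in>?I.
      pmf (map_pmf of_bool (bernoulli_pmf ((sin (r i))\<^sup>2))) (F (i, j)))
      \<in> borel_measurable (opf_angles K N)"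
    by (intro borel_measurable_sum borel_measurable_prod) (auto intro!: ent)
  ultimately show "(\<lambda>r. emeasure (?P r) A) \<in> borel_measurable (opf_angles K N)"
    by (simp add: measure_pmf.emeasure_eq_measure)
qed (auto intro: prob_space_imp_subprob_space measure_pmf.prob_space_axioms)

lemma prob_space_opf_matrix:
  assumes "K \<ge> 1"
  shows "prob_space (opf_matrix K \<epsilon> M)"
proof -
  interpret prob_space "opf_angles K (opf_rows K \<epsilon>)"
    by (rule prob_space_opf_angles[OF assms])
  show ?thesis
    unfolding opf_matrix_def
    by (rule prob_space_bind[OF _ opf_kernel_measurable])
       (simp add: measure_pmf.prob_space_axioms)
qed

lemma sets_opf_matrix:
  assumes "K \<ge> 1"
  shows "sets (opf_matrix K \<epsilon> M) = UNIV"
proof -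
  interpret prob_space "opf_angles K (opf_rows K \<epsilon>)"
    by (rule prob_space_opf_angles[OF assms])
  show ?thesis
    unfolding opf_matrix_def by (subst sets_bind) (auto simp: not_empty)
qed

lemma measure_opf_matrix:
  assumes "K \<ge> 1"
  shows "measure (opf_matrix K \<epsilon> M) A =
    (\<integral>r. measure (measure_pmf (opf_given_bias (opf_rows K \<epsilon>) M (\<lambda>i. (sin (r i))\<^sup>2))) A
       \<partial>opf_angles K (opf_rows K \<epsilon>))"
proof -
  interpret prob_space "opf_angles K (opf_rows K \<epsilon>)"
    by (rule prob_space_opf_angles[OF assms])
  show ?thesis
    unfolding opf_matrix_def by (rule measure_bind[OF opf_kernel_measurable]) simp
qed

lemma determined_rows_iff:
  assumes "K \<ge> 1" "\<And>j. j \<in> {1..K} \<Longrightarrow> F (i, j) \<in> {0, 1}"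
  shows "i \<in> determined_rows N K s F \<longleftrightarrow> i \<in> {1..N} \<and>
    (\<forall>g. (\<forall>j\<in>{1..K}. g j \<in> {0, 1 :: real}) \<and>
         (\<forall>j\<in>{1..K}. g 1 - g j = collusion_matrix s F i j) \<longrightarrow>
         (\<forall>j\<in>{1..K}. g j = F (i, j)))"
    (is "_ \<longleftrightarrow> _ \<and> ?U")
proof -
  have cm: "collusion_matrix s F i j = F (i, 1) - F (i, j)" for j
    by (simp add: collusion_matrix_def received_def)
  have "(\<exists>j\<in>{1..K}. F (i, 1) \<noteq> F (i, j)) \<longleftrightarrow> ?U"
  proof
    assume "\<exists>j\<in>{1..K}. F (i, 1) \<noteq> F (i, j)"
    then obtain k where k: "k \<in> {1..K}" "F (i, 1) \<noteq> F (i, k)" by blast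
    show ?U
    proof (intro allI impI)
      fix g :: "nat \<Rightarrow> real"
      assume g: "(\<forall>j\<in>{1..K}. g j \<in> {0, 1}) \<and>
        (\<forall>j\<in>{1..K}. g 1 - g j = collusion_matrix s F i j)"
      have "g 1 \<in> {0, 1}" "g k \<in> {0, 1}" "g 1 - g k = F (i, 1) - F (i, k)"
        "F (i, 1) \<in> {0, 1}" "F (i, k) \<in> {0, 1}"
        using g k assms by (auto simp: cm)
      hence "g 1 = F (i, 1)" using k(2) by auto
      thus "\<forall>j\<in>{1..K}. g j = F (i, j)" using g by (auto simp: cm)
    qed
  next
    assume U: ?U
    show "\<exists>j\<in>{1..K}. F (i, 1) \<noteq> F (i, j)"
    proof (rule ccontr)
      assume "\<not> ?thesis"
      hence eq: "F (i, j) = F (i, 1)" if "j \<in> {1..K}" for j using that by metis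
      have one: "1 \<in> {1..K}" "F (i, 1) \<in> {0, 1}"
        using assms(1) assms(2)[of 1] by simp_all
      define g :: "nat \<Rightarrow> real" where "g = (\<lambda>_. 1 - F (i, 1))"
      have g01: "\<forall>j\<in>{1..K}. g j \<in> {0, 1}"
        using one(2) unfolding g_def by auto
      have gcm: "\<forall>j\<in>{1..K}. g 1 - g j = collusion_matrix s F i j"
      proof
        fix j assume "j \<in> {1..K}"
        thus "g 1 - g j = collusion_matrix s F i j"
          unfolding cm g_def by (simp add: eq[of j])
      qed
      have "\<forall>j\<in>{1..K}. g j = F (i, j)"
        by (rule U[THEN spec, THEN mp, OF conjI[OF g01 gcm]])
      from bspec[OF this one(1)] have "1 - F (i, 1) = F (i, 1)"
        unfolding g_def .
      thus False using one(2) by auto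
    qed
  qed
  moreover have "i \<in> determined_rows N K s F \<longleftrightarrow>
      i \<in> {1..N} \<and> (\<exists>j\<in>{1..K}. F (i, 1) \<noteq> F (i, j))"
    by (simp add: determined_rows_def cm)
  ultimately show ?thesis by simp
qed

end

theory Submission
  imports Defs
begin

text \<open>
  A row is undetermined iff its first \<open>K\<close> entries agree, which has probability
  \<open>p = E[sin\<^sup>2\<^sup>K r + cos\<^sup>2\<^sup>K r]\<close>, independently over the rows. Wallis' recursion, applied to
  \<open>V\<^sub>n = \<integral> sin\<^sup>2\<^sup>n + cos\<^sup>2\<^sup>n\<close> over \<open>[0, pi/2]\<close>, gives \<open>V\<^sub>n\<^sup>2 (3 n + 1) \<le> pi\<^sup>2\<close>; as the cutoff
  is at most \<open>0.042\<close>, this yields \<open>p \<le> c\<close> with \<open>c = C / sqrt K\<close> and \<open>C = 5/4\<close>.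
  Chebyshev's inequality at distance \<open>2 c N - p N\<close> from the mean (rather than at \<open>c N\<close>, because
  \<open>p (1 - p)\<close> need not be monotone on \<open>[0, c]\<close> when \<open>c > 1/2\<close>) bounds the failure probability by
  \<open>p (1 - p) / (N (2 c - p)\<^sup>2) \<le> (1 - c) / (N c)\<close>.
\<close>

section \<open>Chebyshev's inequality for counts of pairwise independent events\<close>

text \<open>Pairwise independence suffices, since the second moment of the count involves only the
  intersections \<open>B i \<inter> B j\<close>. The upper tail is bounded by the two-sided
  inequality.\<close>

lemma (in prob_space) prob_card_ge_Chebyshev:
  fixes p a :: real
  assumes fin: "finite I" and ev: "\<And>i. i \<in> I \<Longrightarrow> B i \<in> events"
    and single: "\<And>i. i \<in> I \<Longrightarrow> prob (B i) = p"
    and pair: "\<And>i j. i \<in> I \<Longrightarrow> j \<in> I \<Longrightarrow> i \<noteq> j \<Longrightarrow> prob (B i \<inter> B j) = p\<^sup>2"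
    and less: "real (card I) * p < a"
  shows "prob {x\<in>space M. a \<le> real (card {i\<in>I. x \<in> B i})}
    \<le> real (card I) * p * (1 - p) / (a - real (card I) * p)\<^sup>2"
proof -
  define X :: "'a \<Rightarrow> real" where "X x = (\<Sum>i\<in>I. indicator (B i) x)" for x
  let ?n = "real (card I)"
  have X_card: "X x = real (card {i\<in>I. x \<in> B i})" for x
    using fin by (simp add: X_def indicator_def sum.If_cases Int_def conj_commute)
  have X_sq: "(X x)\<^sup>2 = (\<Sum>i\<in>I. \<Sum>j\<in>I. indicator (B i \<inter> B j) x)" for x
    by (simp add: X_def power2_eq_square sum_product indicator_inter_arith)
  have [measurable]: "B i \<in> events" if "i \<in> I" for i
    using ev that .
  have int1: "integrable M X"
    unfolding X_def using ev by (intro Bochner_Integration.integrable_sum) (auto simp: emeasure_eq_measure)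
  have int_ij: "integrable M (\<lambda>x. indicator (B i \<inter> B j) x :: real)" if "i \<in> I" "j \<in> I" for i j
    using ev that by (auto simp: emeasure_eq_measure)
  have int2: "integrable M (\<lambda>x. (X x)\<^sup>2)"
    unfolding X_sq by (intro Bochner_Integration.integrable_sum int_ij)
  have EX: "expectation X = ?n * p"
  proof -
    have "expectation X = (\<Sum>i\<in>I. prob (B i))"
      unfolding X_def using ev
      by (subst Bochner_Integration.integral_sum) (auto simp: emeasure_eq_measure)
    thus ?thesis using single by simp
  qed
  have "expectation (\<lambda>x. (X x)\<^sup>2) = (\<Sum>i\<in>I. \<Sum>j\<in>I. prob (B i \<inter> B j))"
    unfolding X_sq using ev int_ij
    by (subst Bochner_Integration.integral_sum, simp add: Bochner_Integration.integrable_sum)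
       (auto intro!: sum.cong simp: Bochner_Integration.integral_sum)
  \<comment> \<open>Only the diagonal deviates from \<open>p\<^sup>2\<close>:
    \<open>B i \<inter> B i\<close> has probability \<open>p\<close>.\<close>
  also have "\<dots> = (\<Sum>i\<in>I. \<Sum>j\<in>I. p\<^sup>2 + (if i = j then p - p\<^sup>2 else 0))"
    using single pair by (intro sum.cong refl) auto
  also have "\<dots> = ?n * (?n * p\<^sup>2 + (p - p\<^sup>2))"
    using fin by (simp add: sum.distrib)
  finally have var: "variance X = ?n * p * (1 - p)"
    by (subst variance_eq[OF int1 int2]) (simp add: EX algebra_simps power2_eq_square)
  have "prob {x\<in>space M. a \<le> X x} \<le> prob {x\<in>space M. a - ?n * p \<le> \<bar>X x - expectation X\<bar>}"
    using borel_measurable_integrable[OF int1] by (intro finite_measure_mono) (auto simp: EX)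
  also have "\<dots> \<le> variance X / (a - ?n * p)\<^sup>2"
    using less by (intro Chebyshev_inequality int2 borel_measurable_integrable[OF int1]) auto
  finally show ?thesis
    unfolding var by (simp only: X_card)
qed

section \<open>Wallis integrals\<close>

text \<open>Here \<open>V\<close> equals pi times binomial(2n, n) / 4^n, and the bound is the
  classical estimate 1 / sqrt (3n + 1) for that ratio. The factor 3n + 1 makes the induction close:
  it starts with equality at n = 0.\<close>

lemma sin_cos_power_integral:
  obtains V where "((\<lambda>x::real. sin x ^ (2*n) + cos x ^ (2*n)) has_integral V) {0..pi/2}"
    and "V\<^sup>2 * real (3*n+1) \<le> pi\<^sup>2"
proof -
  have "\<exists>V. ((\<lambda>x::real. sin x ^ (2*n) + cos x ^ (2*n)) has_integral V) {0..pi/2}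
    \<and> V\<^sup>2 * real (3*n+1) \<le> pi\<^sup>2"
  proof (induction n)
    case 0
    have "((\<lambda>x::real. 1 + 1) has_integral pi) {0..pi/2}"
      using has_integral_const_real[of "2::real" 0 "pi/2"] by simp
    thus ?case by (intro exI[of _ pi]) simp
  next
    case (Suc n)
    then obtain V where V: "((\<lambda>x::real. sin x ^ (2*n) + cos x ^ (2*n)) has_integral V) {0..pi/2}"
      and bound: "V\<^sup>2 * real (3*n+1) \<le> pi\<^sup>2" by blast
    \<comment> \<open>\<open>?F\<close> vanishes at both endpoints, so integrating its derivative
      \<open>?F'\<close> gives Wallis' recursion with ratio (2n + 1) / (2n + 2).\<close>
    let ?F = "\<lambda>x::real. cos x ^ (2*n+1) * sin x - sin x ^ (2*n+1) * cos x"
    let ?F' = "\<lambda>x::real. (2*real n+2) * (sin x ^ (2*Suc n) + cos x ^ (2*Suc n))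
      - (2*real n+1) * (sin x ^ (2*n) + cos x ^ (2*n))"
    have "(?F has_real_derivative ?F' x) (at x within {0..pi/2})" for x
    proof -
      have pow: "y ^ (2 * Suc n) = y ^ (2*n) * y\<^sup>2" for y :: real
        by (simp add: power2_eq_square)
      have dcos: "((\<lambda>x. cos x ^ (2*n+1)) has_real_derivative real (2*n+1) * cos x ^ (2*n) * (- sin x)) (at x within {0..pi/2})"
        using DERIV_power_Suc[of cos "- sin x" x "{0..pi/2}" "2*n"] DERIV_cos[of x]
        by (simp add: has_field_derivative_at_within algebra_simps)
      have dsin: "((\<lambda>x. sin x ^ (2*n+1)) has_real_derivative real (2*n+1) * sin x ^ (2*n) * cos x) (at x within {0..pi/2})"
        using DERIV_power_Suc[of sin "cos x" x "{0..pi/2}" "2*n"] DERIV_sin[of x]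
        by (simp add: has_field_derivative_at_within algebra_simps)
      have "(?F has_real_derivative (real (2*n+1) * cos x ^ (2*n) * (- sin x) * sin x + cos x * cos x ^ (2*n+1))
        - (real (2*n+1) * sin x ^ (2*n) * cos x * cos x + - sin x * sin x ^ (2*n+1))) (at x within {0..pi/2})"
        by (intro DERIV_diff DERIV_mult dcos dsin has_field_derivative_at_within[OF DERIV_cos]
            has_field_derivative_at_within[OF DERIV_sin])
      also have "(real (2*n+1) * cos x ^ (2*n) * (- sin x) * sin x + cos x * cos x ^ (2*n+1))
        - (real (2*n+1) * sin x ^ (2*n) * cos x * cos x + - sin x * sin x ^ (2*n+1))
        = cos x ^ (2*n) * ((cos x)\<^sup>2 - (2*real n+1) * (sin x)\<^sup>2)
        + sin x ^ (2*n) * ((sin x)\<^sup>2 - (2*real n+1) * (cos x)\<^sup>2)"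
        by (simp add: power2_eq_square algebra_simps)
      also have "\<dots> = ?F' x"
        unfolding pow sin_squared_eq by (simp add: algebra_simps)
      finally show ?thesis .
    qed
    hence "(?F' has_integral (?F (pi/2) - ?F 0)) {0..pi/2}"
      by (intro fundamental_theorem_of_calculus)
         (auto simp: has_real_derivative_iff_has_vector_derivative)
    hence "(?F' has_integral 0) {0..pi/2}"
      by simp
    from has_integral_mult_right[OF has_integral_add[OF this has_integral_mult_right[OF V, of "2*real n+1"]],
        of "1 / (2*real n+2)"]
    have "((\<lambda>x::real. sin x ^ (2*Suc n) + cos x ^ (2*Suc n)) has_integral ((2*real n+1) / (2*real n+2) * V)) {0..pi/2}"
      by (simp add: add_eq_0_iff)
    moreover have "((2*real n+1) / (2*real n+2) * V)\<^sup>2 * real (3*Suc n+1) \<le> pi\<^sup>2"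
    proof -
      \<comment> \<open>After expansion the right side exceeds the left by exactly n.\<close>
      have "(2*real n+1)\<^sup>2 * (3*real n+4) \<le> (2*real n+2)\<^sup>2 * (3*real n+1)"
        by (simp add: power2_eq_square algebra_simps)
      hence "(2*real n+1)\<^sup>2 / (2*real n+2)\<^sup>2 * (3*real n+4) \<le> 3*real n+1"
        by (simp add: pos_divide_le_eq mult.commute)
      from mult_left_mono[OF this, of "V\<^sup>2"]
      have "V\<^sup>2 * ((2*real n+1)\<^sup>2 / (2*real n+2)\<^sup>2 * (3*real n+4)) \<le> V\<^sup>2 * (3*real n+1)"
        by simp
      also have "\<dots> \<le> pi\<^sup>2"
        using bound by (simp add: add.commute)
      finally show ?thesis
        by (simp add: power_divide power_mult_distrib mult.commute mult.left_commute add.commute)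
    qed
    ultimately show ?case by blast
  qed
  thus thesis using that by blast
qed

section \<open>Probability that given rows are constant on the coalition\<close>

text \<open>The failure event of row \<open>i\<close>, written without the host signal, which
  cancels in the differences the colluders form.\<close>

definition constant_row :: "nat \<Rightarrow> nat \<Rightarrow> (nat \<times> nat \<Rightarrow> real) set" where
  "constant_row K i = {F. \<forall>j\<in>{1..K}. F (i, j) = F (i, 1)}"

text \<open>Split by the common value \<open>b i\<close> of each row in \<open>S\<close>. The events
  \<open>E b\<close> are disjoint, independence of the entries gives each of them a product, and
  summing over all 0/1 vectors \<open>b\<close> factorizes row by row. Singletons and pairs
  \<open>S\<close> later supply the two hypotheses of the Chebyshev bound.\<close>

lemma prob_constant_rows_given_bias:
  assumes K: "1 \<le> K" "K \<le> M" and S: "S \<subseteq> {1..N}"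
    and \<rho>: "\<And>i. 0 \<le> \<rho> i" "\<And>i. \<rho> i \<le> 1"
  shows "measure (measure_pmf (opf_given_bias N M \<rho>)) (\<Inter>i\<in>S. constant_row K i)
    = (\<Prod>i\<in>S. \<rho> i ^ K + (1 - \<rho> i) ^ K)"
proof -
  let ?P = "opf_given_bias N M \<rho>"
  let ?B = "PiE S (\<lambda>_. {0, 1 :: real})"
  define q :: "nat \<Rightarrow> real \<Rightarrow> real" where "q i b = (if b = 1 then \<rho> i else 1 - \<rho> i)" for i b
  define E :: "(nat \<Rightarrow> real) \<Rightarrow> (nat \<times> nat \<Rightarrow> real) set"
    where "E b = {F. \<forall>i\<in>S. \<forall>j\<in>{1..K}. F (i, j) = b i}" for b
  have vimage_of_bool: "of_bool -` {0 :: real} = {False}" "of_bool -` {1 :: real} = {True}"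
    by auto
  have finS: "finite S" using S finite_subset by blast
  have finB: "finite ?B" using finS by (intro finite_PiE) auto
  have entry: "F (i, 1) \<in> {0, 1}" if "F \<in> set_pmf ?P" "i \<in> S" for F i
  proof -
    have "(i, 1) \<in> {1..N} \<times> {1..M}" using that S K by auto
    thus ?thesis using that(1)
      by (fastforce simp: opf_given_bias_def set_Pi_pmf PiE_dflt_def)
  qed
  have probE: "measure (measure_pmf ?P) (E b) = (\<Prod>i\<in>S. q i (b i) ^ K)" if b: "b \<in> ?B" for b
  proof -
    \<comment> \<open>Entries outside \<open>S \<times> {1..K}\<close> are unconstrained and
      contribute factors 1.\<close>
    let ?A = "\<lambda>x. if fst x \<in> S \<and> snd x \<in> {1..K} then {b (fst x)} else UNIV"
    have "E b = Pi ({1..N} \<times> {1..M}) ?A"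
      using S K by (auto simp: E_def Pi_def split: if_splits)
    hence "measure (measure_pmf ?P) (E b) = (\<Prod>x\<in>{1..N} \<times> {1..M}.
        measure (measure_pmf (map_pmf of_bool (bernoulli_pmf (\<rho> (fst x))))) (?A x))"
      unfolding opf_given_bias_def by (simp add: measure_Pi_pmf_Pi case_prod_unfold)
    also have "\<dots> = (\<Prod>x\<in>S \<times> {1..K}. q (fst x) (b (fst x)))"
    proof (rule prod.mono_neutral_cong_right)
      fix x assume "x \<in> S \<times> {1..K}"
      hence x: "fst x \<in> S" "snd x \<in> {1..K}" by auto
      define i where "i = fst x"
      have "b i \<in> {0, 1}" using b x by (auto simp: i_def)
      hence "measure (measure_pmf (map_pmf of_bool (bernoulli_pmf (\<rho> i)))) {b i} = q i (b i)"
        using \<rho>[of i] by (auto simp: measure_pmf_single pmf_map q_def vimage_of_bool)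
      thus "measure (measure_pmf (map_pmf of_bool (bernoulli_pmf (\<rho> (fst x))))) (?A x) = q (fst x) (b (fst x))"
        unfolding i_def using x by simp
    qed (use S K in auto)
    also have "\<dots> = (\<Prod>i\<in>S. q i (b i) ^ K)"
      using prod.cartesian_product[of "\<lambda>i _. q i (b i)" "{1..K}" S] by (simp add: case_prod_unfold)
    finally show ?thesis .
  qed
  \<comment> \<open>The two sets agree only up to a null set: entries are real numbers, so a row may
    be constant with a value other than 0 or 1, but not on the support.\<close>
  have "measure (measure_pmf ?P) (\<Inter>i\<in>S. constant_row K i) = measure (measure_pmf ?P) (\<Union>b\<in>?B. E b)"
  proof (rule measure_prob_cong_0)
    fix F assume F: "F \<in> (\<Inter>i\<in>S. constant_row K i) - (\<Union>b\<in>?B. E b)"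
    have "F (i, j) = restrict (\<lambda>i. F (i, 1)) S i" if "i \<in> S" "j \<in> {1..K}" for i j
    proof -
      have "F (i, j) = F (i, 1)"
        using F that unfolding constant_row_def by blast
      thus ?thesis using that by simp
    qed
    hence "F \<in> E (restrict (\<lambda>i. F (i, 1)) S)"
      unfolding E_def by blast
    moreover have "restrict (\<lambda>i. F (i, 1)) S \<in> ?B" if "F \<in> set_pmf ?P"
      using entry[OF that] by auto
    ultimately show "pmf ?P F = 0"
      using F unfolding set_pmf_eq by blast
  next
    fix F assume "F \<in> (\<Union>b\<in>?B. E b) - (\<Inter>i\<in>S. constant_row K i)"
    then obtain b i j where "\<forall>i\<in>S. \<forall>j\<in>{1..K}. F (i, j) = b i" "i \<in> S" "j \<in> {1..K}" "F (i, j) \<noteq> F (i, 1)"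
      unfolding E_def constant_row_def by blast
    moreover have "1 \<in> {1..K}" using K by simp
    ultimately show "pmf ?P F = 0" by metis
  qed
  also have "\<dots> = (\<Sum>b\<in>?B. measure (measure_pmf ?P) (E b))"
  proof (rule measure_pmf.finite_measure_finite_Union[OF finB])
    have "b = b'" if "b \<in> ?B" "b' \<in> ?B" "F \<in> E b" "F \<in> E b'" for b b' F
    proof (rule PiE_ext[OF that(1,2)])
      fix i assume "i \<in> S"
      moreover have "1 \<in> {1..K}" using K by simp
      ultimately have "F (i, 1) = b i" "F (i, 1) = b' i"
        using that(3,4) unfolding E_def by blast+
      thus "b i = b' i" by simp
    qed
    thus "disjoint_family_on E ?B"
      unfolding disjoint_family_on_def by blast
  qed auto
  also have "\<dots> = (\<Sum>b\<in>?B. \<Prod>i\<in>S. q i (b i) ^ K)"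
    by (intro sum.cong refl probE)
  \<comment> \<open>Distributivity, read backwards: a sum over all choices \<open>b\<close> is a
    product of sums.\<close>
  also have "\<dots> = (\<Prod>i\<in>S. \<Sum>y\<in>{0, 1}. q i y ^ K)"
    by (rule prod_sum_PiE[symmetric, OF finS]) simp
  finally show ?thesis
    by (simp add: q_def add.commute)
qed

definition opf_angle :: "nat \<Rightarrow> real measure" where
  "opf_angle K = uniform_measure lborel {opf_cutoff K .. pi / 2 - opf_cutoff K}"

text \<open>The integrand is \<rho>^K + (1 - \<rho>)^K at the bias \<rho> = sin^2 x: all ones or all
  zeros.\<close>

definition constant_row_prob :: "nat \<Rightarrow> real" where
  "constant_row_prob K = (\<integral>x. sin x ^ (2 * K) + cos x ^ (2 * K) \<partial>opf_angle K)"

text \<open>Averaging the conditional law over the angles preserves the product form, because the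
  angles are independent and identically distributed.\<close>

lemma prob_constant_rows:
  assumes K: "1 \<le> K" "K \<le> M" and S: "S \<subseteq> {1..opf_rows K \<epsilon>}"
  shows "measure (opf_matrix K \<epsilon> M) (\<Inter>i\<in>S. constant_row K i) = constant_row_prob K ^ card S"
proof -
  let ?N = "opf_rows K \<epsilon>"
  let ?h = "\<lambda>x::real. sin x ^ (2 * K) + cos x ^ (2 * K)"
  interpret U: prob_space "opf_angle K"
    unfolding opf_angle_def by (rule prob_space_opf_angle[OF K(1)])
  interpret product_sigma_finite "\<lambda>_. opf_angle K"
    by unfold_locales
  have [measurable_cong]: "sets (opf_angle K) = sets borel"
    by (simp add: opf_angle_def)
  have h_le: "norm (?h x) \<le> 2" for x
  proof -
    have "sin x ^ (2 * K) \<le> 1" "cos x ^ (2 * K) \<le> 1"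
      by (simp_all add: power_mult power_le_one abs_square_le_1)
    moreover have "0 \<le> sin x ^ (2 * K)" "0 \<le> cos x ^ (2 * K)"
      by (simp_all add: power_mult)
    ultimately show ?thesis by simp
  qed
  have int: "integrable (opf_angle K) ?h"
  proof (rule U.integrable_const_bound[where B = 2])
    show "AE x in opf_angle K. norm (?h x) \<le> 2"
      by (intro AE_I2 h_le)
  qed measurable
  have "measure (opf_matrix K \<epsilon> M) (\<Inter>i\<in>S. constant_row K i)
      = (\<integral>r. (\<Prod>i\<in>S. ?h (r i)) \<partial>opf_angles K ?N)"
    unfolding measure_opf_matrix[OF K(1)]
  proof (intro Bochner_Integration.integral_cong refl)
    fix r :: "nat \<Rightarrow> real"
    have "measure (measure_pmf (opf_given_bias ?N M (\<lambda>i. (sin (r i))\<^sup>2))) (\<Inter>i\<in>S. constant_row K i)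
        = (\<Prod>i\<in>S. ((sin (r i))\<^sup>2) ^ K + (1 - (sin (r i))\<^sup>2) ^ K)"
      by (rule prob_constant_rows_given_bias[OF K S]) (simp_all add: abs_square_le_1)
    also have "\<dots> = (\<Prod>i\<in>S. ?h (r i))"
      by (simp only: power_mult cos_squared_eq)
    finally show "measure (measure_pmf (opf_given_bias ?N M (\<lambda>i. (sin (r i))\<^sup>2))) (\<Inter>i\<in>S. constant_row K i)
        = (\<Prod>i\<in>S. ?h (r i))" .
  qed
  \<comment> \<open>Rows outside \<open>S\<close> get the constant factor 1, so that the product
    runs over every coordinate of the product measure.\<close>
  also have "\<dots> = (\<integral>r. (\<Prod>i\<in>{1..?N}. (if i \<in> S then ?h else (\<lambda>_. 1)) (r i)) \<partial>Pi\<^sub>M {1..?N} (\<lambda>_. opf_angle K))"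
    unfolding opf_angles_def opf_angle_def
    using S by (intro Bochner_Integration.integral_cong refl prod.mono_neutral_cong_left) auto
  also have "\<dots> = (\<Prod>i\<in>{1..?N}. \<integral>x. (if i \<in> S then ?h else (\<lambda>_. 1)) x \<partial>opf_angle K)"
    by (rule product_integral_prod) (use int in auto)
  also have "\<dots> = (\<Prod>i\<in>S. constant_row_prob K)"
    using S by (intro prod.mono_neutral_cong_right) (auto simp: constant_row_prob_def U.prob_space)
  finally show ?thesis by simp
qed

section \<open>Numerical estimates for the row probability and the Chebyshev ratio\<close>

lemma integral_uniform_measure:
  fixes f :: "'a \<Rightarrow> real"
  assumes A: "A \<in> sets M" "emeasure M A \<noteq> 0" "emeasure M A \<noteq> \<infinity>"
    and [measurable]: "f \<in> borel_measurable M"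
  shows "(\<integral>x. f x \<partial>uniform_measure M A) = (LINT x:A|M. f x) / measure M A"
proof -
  note [measurable] = A(1)
  have "0 < measure M A"
    using A by (simp add: measure_def enn2real_positive_iff less_top zero_less_iff_neq_zero)
  moreover have "emeasure M A = ennreal (measure M A)"
    using A by (simp add: emeasure_eq_ennreal_measure)
  ultimately have "uniform_measure M A = density M (\<lambda>x. ennreal (indicator A x / measure M A))"
    unfolding uniform_measure_def
    by (auto simp: divide_ennreal[symmetric] indicator_def intro!: arg_cong[where f = "density M"])
  thus ?thesis
    by (simp add: integral_density set_lebesgue_integral_def)
qed

text \<open>The Wallis bound gives V sqrt K \<le> pi / sqrt 3 \<le> 0.59 pi, while the angle
  interval has length at least 0.472 pi. The constant 5/4 is the quotient 0.59 / 0.472.\<close>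

lemma constant_row_prob_le:
  assumes K: "4 \<le> K"
  shows "constant_row_prob K \<le> 5 / 4 / sqrt (real K)"
proof -
  define t where "t = opf_cutoff K"
  let ?h = "\<lambda>x::real. sin x ^ (2 * K) + cos x ^ (2 * K)"
  let ?I = "{t..pi/2 - t}"
  have t: "0 < t" "t < pi/4" "(sin t)\<^sup>2 = 1 / (300 * real K)"
    using opf_cutoff[of K] K by (auto simp: t_def)
  \<comment> \<open>The mean value theorem gives t cos(pi/4) \<le> sin t, hence t^2 \<le> 2 / (300
    K) \<le> 1/600, using K \<ge> 4.\<close>
  have "t \<le> 0.042"
  proof -
    obtain z where z: "0 < z" "z < t" "sin t - sin 0 = (t - 0) * cos z"
      using MVT2[OF t(1), of sin cos] DERIV_sin by blast
    have "cos (pi/4) \<le> cos z"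
      using z t by (intro cos_monotone_0_pi_le) auto
    hence "t * cos (pi/4) \<le> sin t"
      using z t by (simp add: mult_left_mono)
    hence "(t * cos (pi/4))\<^sup>2 \<le> (sin t)\<^sup>2"
      using t by (intro power_mono) (auto simp: cos_45)
    hence "t\<^sup>2 / 2 \<le> 1 / (300 * real K)"
      by (simp add: t(3) power_mult_distrib cos_45 power_divide)
    also have "\<dots> \<le> 1 / (300 * 4)"
      using K by (intro divide_left_mono) auto
    finally have "t\<^sup>2 \<le> 0.042\<^sup>2" by (simp add: power2_eq_square)
    thus ?thesis by (rule power2_le_imp_le) simp
  qed
  \<comment> \<open>With pi > 3, the loss 2t \<le> 0.084 is at most 0.028 pi.\<close>
  hence len: "0.472 * pi \<le> pi/2 - 2*t"
    using pi_gt3 by simp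
  hence pos: "0 < pi/2 - 2*t" using pi_gt3 by (intro less_le_trans[OF _ len]) simp
  obtain V where V: "(?h has_integral V) {0..pi/2}" "V\<^sup>2 * real (3*K+1) \<le> pi\<^sup>2"
    by (rule sin_cos_power_integral)
  have h0: "0 \<le> ?h x" for x by (simp add: power_mult)
  have cont: "continuous_on A ?h" for A
    by (intro continuous_intros)
  have setint: "set_integrable lborel ?I ?h"
    unfolding set_integrable_def using borel_integrable_compact[OF compact_Icc cont] by simp
  have "V\<^sup>2 * real K \<le> V\<^sup>2 * real (3*K+1) / 3"
    by (simp add: algebra_simps)
  also have "\<dots> \<le> pi\<^sup>2 / 3"
    using V(2) by simp
  also have "\<dots> \<le> 0.59\<^sup>2 * pi\<^sup>2"
    by (simp add: power2_eq_square)
  finally have "(V * sqrt (real K))\<^sup>2 \<le> (0.59 * pi)\<^sup>2"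
    by (simp only: power_mult_distrib real_sqrt_pow2[OF of_nat_0_le_iff])
  hence "V * sqrt (real K) \<le> 0.59 * pi"
    by (rule power2_le_imp_le) simp
  also have "\<dots> \<le> 5/4 * (pi/2 - 2*t)"
    using len by simp
  finally have V_le: "V * sqrt (real K) \<le> 5/4 * (pi/2 - 2*t)" .
  have "constant_row_prob K = (LINT x:?I|lborel. ?h x) / (pi/2 - 2*t)"
    using pos integral_uniform_measure[of ?I lborel ?h]
    by (simp add: constant_row_prob_def opf_angle_def t_def set_lebesgue_integral_def)
  also have "(LINT x:?I|lborel. ?h x) = integral ?I ?h"
    by (rule set_borel_integral_eq_integral(2)[OF setint])
  also have "integral ?I ?h / (pi/2 - 2*t) \<le> V / (pi/2 - 2*t)"
  proof (rule divide_right_mono)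
    \<comment> \<open>The integrand is nonnegative, so the interval may be enlarged to the one of
      the Wallis integral.\<close>
    have "integral ?I ?h \<le> integral {0..pi/2} ?h"
      using t h0 set_borel_integral_eq_integral(1)[OF setint] has_integral_integrable[OF V(1)]
      by (intro integral_subset_le) auto
    thus "integral ?I ?h \<le> V"
      using V(1) by (simp add: integral_unique)
  qed (use pos in simp)
  also have "\<dots> \<le> 5/4 / sqrt (real K)"
    using V_le pos K by (simp add: divide_simps mult.commute)
  finally show ?thesis by simp
qed

text \<open>After clearing denominators the difference of the two sides is \<open>(p - c) (p - 4 c (1 - c))\<close>.\<close>
lemma chebyshev_ratio_le:
  fixes p c n :: real
  assumes "0 \<le> p" "p \<le> c" "0 < c" "c \<le> 3/4" "0 < n"
  shows "n * p * (1 - p) / (2 * c * n - n * p)\<^sup>2 \<le> (1 - c) / (n * c)"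
proof -
  have "p \<le> c * 1"
    using assms by simp
  \<comment> \<open>This is where c \<le> 3/4 enters; it makes both factors of the product below
    nonpositive.\<close>
  also have "\<dots> \<le> c * (4 * (1 - c))"
    using assms by (intro mult_left_mono) auto
  finally have "p \<le> 4 * c * (1 - c)"
    by (simp only: mult_ac)
  hence "0 \<le> (p - c) * (p - 4 * c * (1 - c))"
    using assms by (intro mult_nonpos_nonpos) auto
  also have "\<dots> = (1 - c) * (2 * c - p)\<^sup>2 - p * (1 - p) * c"
    by (simp add: power2_eq_square algebra_simps)
  finally have "p * (1 - p) / (2 * c - p)\<^sup>2 \<le> (1 - c) / c"
    using assms by (simp add: divide_simps mult.commute)
  from divide_right_mono[OF this, of n] have "p * (1 - p) / (n * (2 * c - p)\<^sup>2) \<le> (1 - c) / (n * c)"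
    using assms by (simp add: mult.commute)
  also have "p * (1 - p) / (n * (2 * c - p)\<^sup>2) = n * p * (1 - p) / (2 * c * n - n * p)\<^sup>2"
  proof -
    have "2 * c * n - n * p = n * (2 * c - p)" by (simp add: algebra_simps)
    thus ?thesis using assms by (simp add: power_mult_distrib power2_eq_square)
  qed
  finally show ?thesis .
qed

section \<open>From constant rows to the collusion attack\<close>

lemma card_determined_rows:
  assumes "1 \<le> K"
  shows "real N - real (card (determined_rows N K s F)) = real (card {i\<in>{1..N}. F \<in> constant_row K i})"
proof -
  let ?D = "{i\<in>{1..N}. F \<in> constant_row K i}"
  have "determined_rows N K s F = {1..N} - ?D"
    unfolding determined_rows_def collusion_matrix_def received_def constant_row_def
    by (simp only: add_diff_cancel_left right_minus_eq mem_Collect_eq) (blast dest: sym)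
  moreover have "?D \<subseteq> {1..N}" by blast
  ultimately show ?thesis
    using card_mono[of "{1..N}" ?D] by (simp add: card_Diff_subset finite_subset of_nat_diff)
qed

theorem mainTheorem4:
  shows "\<exists>C::real. 1 < C \<and> C < 1.3 \<and>
    (\<forall>(K::nat) (\<epsilon>::real) (N::nat) (M::nat) (s :: nat \<Rightarrow> real).
       K \<ge> 4 \<longrightarrow> 0 < \<epsilon> \<longrightarrow> \<epsilon> < 1 \<longrightarrow> N = opf_rows K \<epsilon> \<longrightarrow> M \<ge> K \<longrightarrow>
       measure (opf_matrix K \<epsilon> M)
         {F. real N - real (card (determined_rows N K s F)) \<le> 2 * C * real N / sqrt (real K)}
       \<ge> 1 - (sqrt (real K) - C) / (real N * C))"
proof (intro exI[of _ "5/4"] conjI allI impI)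
  fix K :: nat and \<epsilon> :: real and N M :: nat and s :: "nat \<Rightarrow> real"
  assume K: "4 \<le> K" and \<epsilon>: "0 < \<epsilon>" "\<epsilon> < 1" and N: "N = opf_rows K \<epsilon>" and M: "K \<le> M"
  define c where "c = 5/4 / sqrt (real K)"
  define p where "p = constant_row_prob K"
  let ?X = "\<lambda>F. real (card {i\<in>{1..N}. F \<in> constant_row K i})"
  have K1: "1 \<le> K" using K by simp
  interpret prob_space "opf_matrix K \<epsilon> M"
    by (rule prob_space_opf_matrix[OF K1])
  have sets: "events = UNIV" and space: "space (opf_matrix K \<epsilon> M) = UNIV"
    using sets_opf_matrix[OF K1] sets_eq_imp_space_eq[of "opf_matrix K \<epsilon> M" "count_space UNIV"] by auto
  \<comment> \<open>Since \<epsilon> < 1, the logarithm is positive and its ceiling is at least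
    1.\<close>
  have N0: "0 < N"
    using K \<epsilon> by (simp add: N opf_rows_def ln_div)
  have sq: "2 \<le> sqrt (real K)"
    using K by (intro real_le_rsqrt) simp
  \<comment> \<open>In fact c \<le> 5/8, as sqrt K \<ge> 2.\<close>
  have c: "0 < c" "c \<le> 3/4"
    using sq K by (auto simp: c_def divide_simps)
  have prob: "prob (\<Inter>i\<in>S. constant_row K i) = p ^ card S" if "S \<subseteq> {1..N}" for S
    unfolding p_def using prob_constant_rows[OF K1 M] that N by blast
  have p: "0 \<le> p" "p \<le> c"
    using prob[of "{1}"] N0 measure_nonneg[of "opf_matrix K \<epsilon> M" "constant_row K 1"] constant_row_prob_le[OF K]
    by (auto simp: p_def c_def)
  have "prob {F\<in>space (opf_matrix K \<epsilon> M). 2 * c * real N \<le> ?X F}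
      \<le> real (card {1..N}) * p * (1 - p) / (2 * c * real N - real (card {1..N}) * p)\<^sup>2"
  proof (rule prob_card_ge_Chebyshev)
    show "prob (constant_row K i) = p" if "i \<in> {1..N}" for i
      using prob[of "{i}"] that by simp
    show "prob (constant_row K i \<inter> constant_row K j) = p\<^sup>2"
      if "i \<in> {1..N}" "j \<in> {1..N}" "i \<noteq> j" for i j
      using prob[of "{i, j}"] that by (simp add: numeral_2_eq_2)
    have "p * real N < 2 * c * real N"
      using p c N0 by (intro mult_strict_right_mono) auto
    thus "real (card {1..N}) * p < 2 * c * real N"
      by (simp add: mult.commute)
  qed (auto simp: sets)
  also have "\<dots> \<le> (1 - c) / (real N * c)"
    using chebyshev_ratio_le[OF p c, of "real N"] N0 by simp
  \<comment> \<open>Numerator and denominator are multiplied by sqrt K, since c sqrt K =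
    5/4.\<close>
  also have "\<dots> = (sqrt (real K) - 5/4) / (real N * (5/4))"
    using K N0 by (simp add: c_def field_simps)
  finally have bad: "prob {F. 2 * c * real N \<le> ?X F} \<le> (sqrt (real K) - 5/4) / (real N * (5/4))"
    by (simp add: space)
  have "1 - prob {F. 2 * c * real N \<le> ?X F} = prob (- {F. 2 * c * real N \<le> ?X F})"
    using prob_compl[of "{F. 2 * c * real N \<le> ?X F}"] by (simp add: sets space Compl_eq_Diff_UNIV)
  \<comment> \<open>The complement says that the number of failures is strictly below 2 c N, which
    is weakened to the non-strict bound.\<close>
  also have "\<dots> \<le> prob {F. real N - real (card (determined_rows N K s F)) \<le> 2 * (5/4) * real N / sqrt (real K)}"
    using K1 by (intro finite_measure_mono) (auto simp: sets card_determined_rows c_def)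
  finally show "1 - (sqrt (real K) - 5/4) / (real N * (5/4))
    \<le> prob {F. real N - real (card (determined_rows N K s F)) \<le> 2 * (5/4) * real N / sqrt (real K)}"
    using bad by simp
qed auto

end
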